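(* Let $A,B$ be two non-zero bounded linear operators on a complex Hilbert space $\mathcal{H}$, and let $T=\begin{pmatrix} 0 & A\\ B & 0\end{pmatrix}\in\mathcal{B}(\mathcal{H}\oplus\mathcal{H})$. Then $$dw^2(T)\leq\begin{cases}\dfrac{\left(\|A\|+\|B\|\right)^2+4\|A\|^2\|B\|^2}{4\left\{1-(\|A\|-\|B\|)^2\right\}}, & \text{if } \dfrac{-1}{2\|B\|^2}<\dfrac{\|A\|-\|B\|}{\|A\|+\|B\|}<\dfrac{1}{2\|A\|^2},\\[3mm] \max\left\{\|A\|^4,\|B\|^4\right\}, & \text{otherwise}.\end{cases}$$ Moreover, the upper bound is attained (that is, equality holds) if there exist non-zero vectors $u_0,v_0\in\mathcal{H}$ such that $Au_0=\|A\|u_0$, $Bv_0=\|B\|v_0$ and $u_0=\lambda v_0$ for some $\lambda\in\mathbb{R}$.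
   Context: $\mathcal{B}(\mathcal{H})$ is the algebra of bounded linear operators on the complex Hilbert space $\mathcal{H}$, with operator norm $\|\cdot\|$. A $2\times2$ operator matrix acts on the Hilbert space direct sum $\mathcal{H}\oplus\mathcal{H}$ (norm $\|(x,y)\|^2=\|x\|^2+\|y\|^2$) in the usual way. For a bounded operator $T$ on a complex Hilbert space, the Davis-Wielandt radius is $dw(T)=\sup\{\sqrt{|\langle Tz,z\rangle|^2+\|Tz\|^4}: \|z\|=1\}$, and $dw^2(T)=(dw(T))^2$. *)

theory Defs
  imports "HOL-Analysis.Analysis"
begin

text \<open>
  Complex Hilbert spaces. The inner product is linear in the first argument, and the last
  axiom makes it induce the norm (hence it is positive definite); completeness comes from
  \<^class>\<open>banach\<close>.
\<close>

class complex_hilbert = banach +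
  fixes scaleC :: "complex \<Rightarrow> 'a \<Rightarrow> 'a" (infixr "*\<^sub>C" 75)
    and cinner :: "'a \<Rightarrow> 'a \<Rightarrow> complex"
  assumes scaleC_add_right: "c *\<^sub>C (x + y) = c *\<^sub>C x + c *\<^sub>C y"
    and scaleC_add_left: "(c + d) *\<^sub>C x = c *\<^sub>C x + d *\<^sub>C x"
    and scaleC_scaleC: "c *\<^sub>C (d *\<^sub>C x) = (c * d) *\<^sub>C x"
    and scaleC_of_real: "complex_of_real r *\<^sub>C x = r *\<^sub>R x"
    and cinner_commute: "cinner x y = cnj (cinner y x)"
    and cinner_add_left: "cinner (x + y) z = cinner x z + cinner y z"
    and cinner_scaleC_left: "cinner (c *\<^sub>C x) y = c * cinner x y"
    and cinner_self: "cinner x x = complex_of_real ((norm x)\<^sup>2)"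

instantiation complex :: complex_hilbert
begin

definition scaleC_complex :: "complex \<Rightarrow> complex \<Rightarrow> complex"
  where "scaleC_complex c x = c * x"

definition cinner_complex :: "complex \<Rightarrow> complex \<Rightarrow> complex"
  where "cinner_complex x y = x * cnj y"

instance
  by standard
    (simp_all add: scaleC_complex_def cinner_complex_def algebra_simps scaleR_conv_of_real
      complex_norm_square del: of_real_power)

end

text \<open>
  The Hilbert space direct sum. The library norm on pairs is already
  \<open>norm (x, y) = sqrt ((norm x)\<^sup>2 + (norm y)\<^sup>2)\<close>.
\<close>

instantiation prod :: (complex_hilbert, complex_hilbert) complex_hilbert
begin

definition scaleC_prod :: "complex \<Rightarrow> 'a \<times> 'b \<Rightarrow> 'a \<times> 'b"
  where "scaleC_prod c z = (c *\<^sub>C fst z, c *\<^sub>C snd z)"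

definition cinner_prod :: "'a \<times> 'b \<Rightarrow> 'a \<times> 'b \<Rightarrow> complex"
  where "cinner_prod z w = cinner (fst z) (fst w) + cinner (snd z) (snd w)"

instance
proof
  fix c d :: complex and r :: real and x y z :: "'a \<times> 'b"
  show "c *\<^sub>C (x + y) = c *\<^sub>C x + c *\<^sub>C y"
    by (simp add: scaleC_prod_def scaleC_add_right)
  show "(c + d) *\<^sub>C x = c *\<^sub>C x + d *\<^sub>C x"
    by (simp add: scaleC_prod_def scaleC_add_left)
  show "c *\<^sub>C (d *\<^sub>C x) = (c * d) *\<^sub>C x"
    by (simp add: scaleC_prod_def scaleC_scaleC)
  show "complex_of_real r *\<^sub>C x = r *\<^sub>R x"
    by (simp add: scaleC_prod_def scaleC_of_real scaleR_prod_def)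
  show "cinner x y = cnj (cinner y x)"
    using cinner_commute[of "fst x" "fst y"] cinner_commute[of "snd x" "snd y"]
    by (simp add: cinner_prod_def)
  show "cinner (x + y) z = cinner x z + cinner y z"
    by (simp add: cinner_prod_def cinner_add_left)
  show "cinner (c *\<^sub>C x) y = c * cinner x y"
    by (simp add: cinner_prod_def scaleC_prod_def cinner_scaleC_left algebra_simps)
  show "cinner x x = complex_of_real ((norm x)\<^sup>2)"
    by (simp add: cinner_prod_def cinner_self norm_prod_def)
qed

end

definition bounded_clinear :: "('a::complex_hilbert \<Rightarrow> 'b::complex_hilbert) \<Rightarrow> bool"
  where "bounded_clinear f \<longleftrightarrow> bounded_linear f \<and> (\<forall>c x. f (c *\<^sub>C x) = c *\<^sub>C f x)"

definition op_matrix ::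
  "('h::complex_hilbert \<Rightarrow> 'h) \<Rightarrow> ('h \<Rightarrow> 'h) \<Rightarrow> ('h \<Rightarrow> 'h) \<Rightarrow> ('h \<Rightarrow> 'h) \<Rightarrow> 'h \<times> 'h \<Rightarrow> 'h \<times> 'h"
  where "op_matrix A B C D = (\<lambda>(x, y). (A x + B y, C x + D y))"

lemma bounded_clinear_op_matrix:
  assumes "bounded_clinear A" "bounded_clinear B" "bounded_clinear C" "bounded_clinear D"
  shows "bounded_clinear (op_matrix A B C D)"
proof -
  have "bounded_linear (\<lambda>z. (A (fst z) + B (snd z), C (fst z) + D (snd z)))"
    using assms unfolding bounded_clinear_def
    by (intro bounded_linear_Pair bounded_linear_add)
      (auto intro: bounded_linear_compose bounded_linear_fst bounded_linear_snd)
  then show ?thesis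
    using assms
    by (simp add: bounded_clinear_def op_matrix_def scaleC_prod_def case_prod_unfold scaleC_add_right)
qed

text \<open>
  For a bounded operator on a non-zero space the supremum below is over a non-empty set that is
  bounded above, so the real-valued \<^const>\<open>Sup\<close> is the genuine supremum.
\<close>

definition dw :: "('a::complex_hilbert \<Rightarrow> 'a) \<Rightarrow> real"
  where "dw T = (SUP z\<in>{z. norm z = 1}. sqrt ((cmod (cinner (T z) z))\<^sup>2 + norm (T z) ^ 4))"

end

theory Submission
  imports Defs
begin

text \<open>
  For a unit vector \<open>(x, y)\<close> put \<open>t = \<parallel>y\<parallel>\<^sup>2\<close>, \<open>a = \<parallel>A\<parallel>\<close>, \<open>b = \<parallel>B\<parallel>\<close>. By Cauchy--Schwarz the quantity under
  the root is at most \<open>(a + b)\<^sup>2 t (1 - t) + (b\<^sup>2 + (a\<^sup>2 - b\<^sup>2) t)\<^sup>2\<close>, which equals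
  \<open>(1 - t) b\<^sup>4 + t a\<^sup>4 + t (1 - t) D\<close> with \<open>D = (a + b)\<^sup>2 (1 - (a - b)\<^sup>2)\<close>. This quadratic has an interior
  maximum on \<open>[0, 1]\<close> precisely when \<open>\<bar>a\<^sup>4 - b\<^sup>4\<bar> < D\<close>, which is the case distinction of the theorem.
  If \<open>A\<close> and \<open>B\<close> attain their norms on a common unit eigenvector \<open>e\<close>, then the unit vectors
  \<open>(sqrt (1 - t) e, sqrt t e)\<close> realise every value of the quadratic.
\<close>

section \<open>Sesquilinearity and the Cauchy-Schwarz inequality\<close>

lemma cinner_add_right: "cinner x (y + z) = cinner x y + cinner x z"
  for x y z :: "'a::complex_hilbert"
  by (metis cinner_add_left cinner_commute complex_cnj_add)

lemma cinner_scaleC_right: "cinner x (c *\<^sub>C y) = cnj c * cinner x y"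
  for x y :: "'a::complex_hilbert"
  by (metis cinner_commute cinner_scaleC_left complex_cnj_mult)

lemma cinner_scaleR_left: "cinner (r *\<^sub>R x) y = of_real r * cinner x y"
  for x y :: "'a::complex_hilbert"
  by (metis cinner_scaleC_left scaleC_of_real)

lemma cinner_scaleR_right: "cinner x (r *\<^sub>R y) = of_real r * cinner x y"
  for x y :: "'a::complex_hilbert"
  by (metis cinner_scaleC_right complex_cnj_complex_of_real scaleC_of_real)

lemma cinner_Cauchy_Schwarz: "cmod (cinner x y) \<le> norm x * norm y"
  for x y :: "'a::complex_hilbert"
proof (cases "y = 0")
  case True
  have "cinner x (0 *\<^sub>R y) = 0"
    by (subst cinner_scaleR_right) simp
  with True show ?thesis by simp
next
  case False
  define c where "c = cinner x y"
  \<comment> \<open>This is \<open>(norm y)\<^sup>2\<close> times the component of \<open>x\<close>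
    orthogonal to \<open>y\<close>, scaled so that no division occurs. Orthogonality kills the
    second term of \<open>cinner w w\<close>, and nonnegativity of the rest is the claim.\<close>
  define w where "w = ((norm y)\<^sup>2) *\<^sub>R x + (- c) *\<^sub>C y"
  have yx: "cinner y x = cnj c"
    unfolding c_def by (rule cinner_commute)
  have "complex_of_real ((norm w)\<^sup>2) = cinner w w"
    by (simp add: cinner_self)
  also have "\<dots> = of_real ((norm y)\<^sup>2) * cinner x w - c * cinner y w"
    by (subst (1) w_def) (simp only: cinner_add_left cinner_scaleC_left cinner_scaleR_left, simp)
  also have "cinner x w = of_real ((norm y)\<^sup>2) * of_real ((norm x)\<^sup>2) - cnj c * c"
    unfolding w_def cinner_add_right cinner_scaleC_right cinner_scaleR_right cinner_self
    by (simp add: c_def)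
  also have "cinner y w = 0"
    unfolding w_def cinner_add_right cinner_scaleC_right cinner_scaleR_right cinner_self yx
    by simp
  also have "of_real ((norm y)\<^sup>2) * (of_real ((norm y)\<^sup>2) * of_real ((norm x)\<^sup>2) - cnj c * c) - c * 0
      = complex_of_real ((norm y)\<^sup>2 * ((norm x)\<^sup>2 * (norm y)\<^sup>2 - (cmod c)\<^sup>2))"
    by (simp add: complex_norm_square mult.commute del: of_real_power)
  finally have "(norm y)\<^sup>2 * ((norm x)\<^sup>2 * (norm y)\<^sup>2 - (cmod c)\<^sup>2) = (norm w)\<^sup>2"
    using of_real_eq_iff by metis
  then have "0 \<le> (norm y)\<^sup>2 * ((norm x)\<^sup>2 * (norm y)\<^sup>2 - (cmod c)\<^sup>2)"
    by simp
  then have "(cmod c)\<^sup>2 \<le> (norm x * norm y)\<^sup>2"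
    using False by (simp add: zero_le_mult_iff power_mult_distrib)
  then show ?thesis
    unfolding c_def by (rule power2_le_imp_le) simp
qed

section \<open>From pointwise estimates to the Davis-Wielandt radius\<close>

text \<open>The root is monotone, so the bound passes to the supremum. The vector \<open>e\<close>
  keeps the index set non-empty, where \<open>Sup\<close> is meaningful, and also yields
  \<open>0 \<le> M\<close>.\<close>

lemma dw_square_le:
  fixes T :: "'a::complex_hilbert \<Rightarrow> 'a"
  assumes unit: "norm (e::'a) = 1"
    and le: "\<And>z. norm z = 1 \<Longrightarrow> (cmod (cinner (T z) z))\<^sup>2 + norm (T z) ^ 4 \<le> M"
  shows "(dw T)\<^sup>2 \<le> M"
proof -
  let ?f = "\<lambda>z. sqrt ((cmod (cinner (T z) z))\<^sup>2 + norm (T z) ^ 4)"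
  have "bdd_above (?f ` {z. norm z = 1})"
    using le by (intro bdd_aboveI2[where M = "sqrt M"]) simp
  then have "?f e \<le> dw T"
    unfolding dw_def using unit by (intro cSUP_upper) simp_all
  \<comment> \<open>Squaring \<open>dw T \<le> sqrt M\<close> is monotone only for nonnegative
    \<open>dw T\<close>.\<close>
  then have "0 \<le> dw T"
    by (rule order_trans[rotated]) simp
  moreover have "dw T \<le> sqrt M"
    unfolding dw_def using unit le by (intro cSUP_least) auto
  moreover have "0 \<le> M"
    using le[OF unit] by (rule order_trans[rotated]) simp
  ultimately show ?thesis
    by (metis power_mono real_sqrt_pow2)
qed

lemma dw_square_eq:
  fixes T :: "'a::complex_hilbert \<Rightarrow> 'a"
  assumes unit: "norm e = 1"
    and le: "\<And>z. norm z = 1 \<Longrightarrow> (cmod (cinner (T z) z))\<^sup>2 + norm (T z) ^ 4 \<le> M"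
    and eq: "(cmod (cinner (T e) e))\<^sup>2 + norm (T e) ^ 4 = M"
  shows "(dw T)\<^sup>2 = M"
proof (rule antisym)
  show "(dw T)\<^sup>2 \<le> M"
    using unit le by (rule dw_square_le)
  let ?f = "\<lambda>z. sqrt ((cmod (cinner (T z) z))\<^sup>2 + norm (T z) ^ 4)"
  have "bdd_above (?f ` {z. norm z = 1})"
    using le by (intro bdd_aboveI2[where M = "sqrt M"]) simp
  then have "?f e \<le> dw T"
    unfolding dw_def using unit by (intro cSUP_upper) simp_all
  then show "M \<le> (dw T)\<^sup>2"
    unfolding eq by (rule sqrt_le_D)
qed

section \<open>Maximum of a quadratic on the unit interval\<close>

text \<open>Here \<open>p\<close> and \<open>q\<close> are the endpoint values and
  \<open>- 2 * D\<close> is the second derivative. For \<open>D > 0\<close> the vertex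
  \<open>(D + q - p) / (2 * D)\<close> is interior exactly if \<open>\<bar>q - p\<bar> < D\<close>;
  otherwise an endpoint is maximal.\<close>

lemma quadratic_max_unit_interval:
  fixes p q D :: real
  defines "h \<equiv> \<lambda>t. (1 - t) * p + t * q + t * (1 - t) * D"
    and "M \<equiv> if \<bar>q - p\<bar> < D then p + (D + q - p)\<^sup>2 / (4 * D) else max p q"
  shows "t \<in> {0..1} \<Longrightarrow> h t \<le> M" and "\<exists>t\<in>{0..1}. h t = M"
proof -
  show "h t \<le> M" if t: "t \<in> {0..1}"
  proof (cases "\<bar>q - p\<bar> < D")
    case True
    then have D: "D > 0" by linarith
    \<comment> \<open>Completing the square about the vertex.\<close>
    have "M - h t = (D + q - p - 2 * t * D)\<^sup>2 / (4 * D)"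
      using True D unfolding M_def h_def by (simp add: field_simps power2_eq_square)
    also have "\<dots> \<ge> 0"
      using D by simp
    finally show ?thesis by simp
  next
    case False
    \<comment> \<open>In turn: \<open>h\<close> is convex and lies below its chord, \<open>h\<close>
      is nondecreasing, \<open>h\<close> is nonincreasing on the interval.\<close>
    then consider "D \<le> 0" | "0 < D" "D \<le> q - p" | "0 < D" "D \<le> p - q"
      by linarith
    then have "h t \<le> max p q"
    proof cases
      case 1
      then have "t * (1 - t) * D \<le> 0"
        using t by (intro mult_nonneg_nonpos) auto
      moreover have "(1 - t) * p \<le> (1 - t) * max p q" "t * q \<le> t * max p q"
        using t by (auto intro!: mult_left_mono)
      ultimately show ?thesis
        unfolding h_def by (simp add: algebra_simps)
    next
      case 2
      have "t * D \<le> 1 * D"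
        using t 2 by (intro mult_right_mono) auto
      with 2 have "t * D \<le> q - p" by linarith
      then have "0 \<le> (1 - t) * (q - p - t * D)"
        using t by (intro mult_nonneg_nonneg) auto
      also have "\<dots> = q - h t"
        unfolding h_def by (simp add: algebra_simps)
      finally show ?thesis by simp
    next
      case 3
      have "(1 - t) * D \<le> 1 * D"
        using t 3 by (intro mult_right_mono) auto
      with 3 have "(1 - t) * D \<le> p - q" by linarith
      then have "0 \<le> t * (p - q - (1 - t) * D)"
        using t by (intro mult_nonneg_nonneg) auto
      also have "\<dots> = p - h t"
        unfolding h_def by (simp add: algebra_simps)
      finally show ?thesis by simp
    qed
    with False show ?thesis
      unfolding M_def by simp
  qed
  show "\<exists>t\<in>{0..1}. h t = M"
  proof (cases "\<bar>q - p\<bar> < D")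
    case True
    then have D: "D > 0" by linarith
    let ?t = "(D + q - p) / (2 * D)"
    have "?t \<in> {0..1}"
      using True D by (auto simp: field_simps abs_if split: if_splits)
    moreover have "h ?t = M"
      using True D unfolding M_def h_def by (simp add: field_simps power2_eq_square)
    ultimately show ?thesis by blast
  next
    case False
    have "h 0 = p" "h 1 = q"
      by (simp_all add: h_def)
    with False show ?thesis
      unfolding M_def max_def by (metis atLeastAtMost_iff order_refl zero_le_one)
  qed
qed

text \<open>Expanding the square shows that \<open>g\<close> is the preceding quadratic with
  \<open>p = b ^ 4\<close> and \<open>q = a ^ 4\<close>. The two inequalities in \<open>M\<close>
  jointly say \<open>\<bar>a ^ 4 - b ^ 4\<bar> < D\<close>, which forces \<open>D > 0\<close> and
  hence a positive denominator.\<close>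

lemma dw_offdiag_quadratic_max:
  fixes a b :: real
  assumes a: "0 < a" and b: "0 < b"
  defines "g \<equiv> \<lambda>t. (a + b)\<^sup>2 * (t * (1 - t)) + (a\<^sup>2 * t + b\<^sup>2 * (1 - t))\<^sup>2"
    and "M \<equiv> if - 1 / (2 * b\<^sup>2) < (a - b) / (a + b) \<and> (a - b) / (a + b) < 1 / (2 * a\<^sup>2)
      then ((a + b)\<^sup>2 + 4 * a\<^sup>2 * b\<^sup>2) / (4 * (1 - (a - b)\<^sup>2)) else max (a ^ 4) (b ^ 4)"
  shows "t \<in> {0..1} \<Longrightarrow> g t \<le> M" and "\<exists>t\<in>{0..1}. g t = M"
proof -
  define D where "D = (a + b)\<^sup>2 * (1 - (a - b)\<^sup>2)"
  have g: "g t = (1 - t) * b ^ 4 + t * a ^ 4 + t * (1 - t) * D" for t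
    unfolding g_def D_def by algebra
  have "- 1 / (2 * b\<^sup>2) < (a - b) / (a + b) \<longleftrightarrow> 0 < (a + b) + 2 * b\<^sup>2 * (a - b)"
    using a b by (simp add: field_simps)
  \<comment> \<open>Both \<open>D\<close> and \<open>a ^ 4 - b ^ 4\<close> contain the factor
    \<open>a + b\<close>; restoring this positive factor makes them appear.\<close>
  also have "\<dots> \<longleftrightarrow> 0 < (a + b) * ((a + b) + 2 * b\<^sup>2 * (a - b))"
    using a b by (simp add: zero_less_mult_iff)
  also have "(a + b) * ((a + b) + 2 * b\<^sup>2 * (a - b)) = D + a ^ 4 - b ^ 4"
    unfolding D_def by algebra
  finally have left: "- 1 / (2 * b\<^sup>2) < (a - b) / (a + b) \<longleftrightarrow> 0 < D + a ^ 4 - b ^ 4" .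
  have "(a - b) / (a + b) < 1 / (2 * a\<^sup>2) \<longleftrightarrow> 0 < (a + b) - 2 * a\<^sup>2 * (a - b)"
    using a b by (simp add: field_simps)
  also have "\<dots> \<longleftrightarrow> 0 < (a + b) * ((a + b) - 2 * a\<^sup>2 * (a - b))"
    using a b by (simp add: zero_less_mult_iff)
  also have "(a + b) * ((a + b) - 2 * a\<^sup>2 * (a - b)) = D - a ^ 4 + b ^ 4"
    unfolding D_def by algebra
  finally have right: "(a - b) / (a + b) < 1 / (2 * a\<^sup>2) \<longleftrightarrow> 0 < D - a ^ 4 + b ^ 4" .
  \<comment> \<open>The vertex value takes the closed form of the theorem once
    \<open>(a + b)\<^sup>2\<close> cancels.\<close>
  have val: "((a + b)\<^sup>2 + 4 * a\<^sup>2 * b\<^sup>2) / (4 * (1 - (a - b)\<^sup>2)) = b ^ 4 + (D + a ^ 4 - b ^ 4)\<^sup>2 / (4 * D)"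
    if "0 < D"
  proof -
    let ?E = "1 - (a - b)\<^sup>2"
    have E: "?E \<noteq> 0"
      using that unfolding D_def by auto
    have "D + a ^ 4 - b ^ 4 = (a + b) * ((a + b) + 2 * b\<^sup>2 * (a - b))"
      unfolding D_def by algebra
    then have "(D + a ^ 4 - b ^ 4)\<^sup>2 / (4 * D)
        = ((a + b)\<^sup>2 * ((a + b) + 2 * b\<^sup>2 * (a - b))\<^sup>2) / ((a + b)\<^sup>2 * (4 * ?E))"
      unfolding D_def by (simp add: power_mult_distrib mult.left_commute)
    also have "\<dots> = ((a + b) + 2 * b\<^sup>2 * (a - b))\<^sup>2 / (4 * ?E)"
      using a b by (intro mult_divide_mult_cancel_left) auto
    finally have "b ^ 4 + (D + a ^ 4 - b ^ 4)\<^sup>2 / (4 * D)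
        = (b ^ 4 * (4 * ?E) + ((a + b) + 2 * b\<^sup>2 * (a - b))\<^sup>2) / (4 * ?E)"
      using E by (simp add: add_divide_distrib)
    also have "b ^ 4 * (4 * ?E) + ((a + b) + 2 * b\<^sup>2 * (a - b))\<^sup>2 = (a + b)\<^sup>2 + 4 * a\<^sup>2 * b\<^sup>2"
      by algebra
    finally show ?thesis ..
  qed
  have M: "M = (if \<bar>a ^ 4 - b ^ 4\<bar> < D then b ^ 4 + (D + a ^ 4 - b ^ 4)\<^sup>2 / (4 * D)
    else max (b ^ 4) (a ^ 4))"
  proof (cases "\<bar>a ^ 4 - b ^ 4\<bar> < D")
    case True
    then have "0 < D" "0 < D + a ^ 4 - b ^ 4" "0 < D - a ^ 4 + b ^ 4" by linarith+
    then show ?thesis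
      unfolding M_def left right using True val by simp
  next
    case False
    then have "\<not> (0 < D + a ^ 4 - b ^ 4 \<and> 0 < D - a ^ 4 + b ^ 4)" by linarith
    then show ?thesis
      unfolding M_def left right using False by (simp only: if_False max.commute)
  qed
  show "t \<in> {0..1} \<Longrightarrow> g t \<le> M" and "\<exists>t\<in>{0..1}. g t = M"
    unfolding g M using quadratic_max_unit_interval[where p = "b ^ 4" and q = "a ^ 4" and D = D]
    by blast+
qed

section \<open>Estimates for the off-diagonal operator matrix\<close>

text \<open>The inner product is \<open>cinner (A y) x + cinner (B x) y\<close>; both terms carry
  the factor \<open>norm x * norm y\<close>, whose square is \<open>t * (1 - t)\<close>. The fourth
  power is handled as the square of the squared norm.\<close>

lemma offdiag_Davis_Wielandt_le:
  fixes A B :: "'h::complex_hilbert \<Rightarrow> 'h"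
  assumes A: "bounded_linear A" and B: "bounded_linear B"
    and unit: "norm (x, y) = 1"
  defines "T \<equiv> op_matrix (\<lambda>x. 0) A B (\<lambda>x. 0)" and "a \<equiv> onorm A" and "b \<equiv> onorm B"
    and "t \<equiv> (norm y)\<^sup>2"
  shows "(cmod (cinner (T (x, y)) (x, y)))\<^sup>2 + norm (T (x, y)) ^ 4
    \<le> (a + b)\<^sup>2 * (t * (1 - t)) + (a\<^sup>2 * t + b\<^sup>2 * (1 - t))\<^sup>2"
proof -
  have x: "(norm x)\<^sup>2 = 1 - t"
    using unit unfolding t_def by (simp add: norm_Pair)
  have T: "T (x, y) = (A y, B x)"
    unfolding T_def op_matrix_def by simp
  have nA: "norm (A y) \<le> a * norm y" and nB: "norm (B x) \<le> b * norm x"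
    unfolding a_def b_def using A B by (auto intro: onorm)
  have "cmod (cinner (T (x, y)) (x, y)) \<le> cmod (cinner (A y) x) + cmod (cinner (B x) y)"
    unfolding T by (simp add: cinner_prod_def norm_triangle_ineq)
  also have "\<dots> \<le> norm (A y) * norm x + norm (B x) * norm y"
    by (intro add_mono cinner_Cauchy_Schwarz)
  also have "\<dots> \<le> (a * norm y) * norm x + (b * norm x) * norm y"
    by (intro add_mono mult_right_mono nA nB) auto
  also have "\<dots> = (a + b) * (norm x * norm y)"
    by (simp add: algebra_simps)
  finally have "(cmod (cinner (T (x, y)) (x, y)))\<^sup>2 \<le> ((a + b) * (norm x * norm y))\<^sup>2"
    by (intro power_mono) auto
  also have "\<dots> = (a + b)\<^sup>2 * (t * (1 - t))"
    unfolding power_mult_distrib x by (simp add: t_def)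
  finally have 1: "(cmod (cinner (T (x, y)) (x, y)))\<^sup>2 \<le> (a + b)\<^sup>2 * (t * (1 - t))" .
  have "(norm (T (x, y)))\<^sup>2 = (norm (A y))\<^sup>2 + (norm (B x))\<^sup>2"
    unfolding T by (simp add: norm_Pair)
  also have "\<dots> \<le> (a * norm y)\<^sup>2 + (b * norm x)\<^sup>2"
    by (intro add_mono power_mono nA nB) auto
  also have "\<dots> = a\<^sup>2 * t + b\<^sup>2 * (1 - t)"
    unfolding power_mult_distrib x by (simp add: t_def)
  finally have "((norm (T (x, y)))\<^sup>2)\<^sup>2 \<le> (a\<^sup>2 * t + b\<^sup>2 * (1 - t))\<^sup>2"
    by (intro power_mono) auto
  with 1 show ?thesis
    by (simp flip: power_mult)
qed

text \<open>All components are real multiples of \<open>e\<close>, so both terms can be computed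
  exactly. When \<open>a\<close> and \<open>b\<close> are the operator norms, this is equality in
  \<open>offdiag_Davis_Wielandt_le\<close> for the same \<open>t\<close>.\<close>

lemma offdiag_Davis_Wielandt_common_eigenvector:
  fixes A B :: "'h::complex_hilbert \<Rightarrow> 'h"
  assumes A: "bounded_linear A" and B: "bounded_linear B"
    and e: "norm e = 1" "A e = a *\<^sub>R e" "B e = b *\<^sub>R e"
    and t: "t \<in> {0..1}"
  defines "T \<equiv> op_matrix (\<lambda>x. 0) A B (\<lambda>x. 0)"
    and "z \<equiv> (sqrt (1 - t) *\<^sub>R e, sqrt t *\<^sub>R e)"
  shows "norm z = 1"
    and "(cmod (cinner (T z) z))\<^sup>2 + norm (T z) ^ 4
      = (a + b)\<^sup>2 * (t * (1 - t)) + (a\<^sup>2 * t + b\<^sup>2 * (1 - t))\<^sup>2"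
proof -
  let ?c = "sqrt (1 - t)" and ?s = "sqrt t"
  have sq: "?c\<^sup>2 = 1 - t" "?s\<^sup>2 = t"
    using t by auto
  show "norm z = 1"
    unfolding z_def using e(1) sq by (simp add: norm_Pair)
  have T: "T z = ((?s * a) *\<^sub>R e, (?c * b) *\<^sub>R e)"
    unfolding T_def z_def op_matrix_def using e
    by (simp add: linear_scale[OF bounded_linear.linear[OF A]] linear_scale[OF bounded_linear.linear[OF B]])
  have "cinner (T z) z = of_real ((a + b) * (?c * ?s))"
    unfolding T unfolding z_def
    by (simp add: cinner_prod_def cinner_scaleR_left cinner_scaleR_right cinner_self e(1) algebra_simps)
  then have "(cmod (cinner (T z) z))\<^sup>2 = ((a + b) * (?c * ?s))\<^sup>2"
    by (simp only: norm_of_real power2_abs)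
  also have "\<dots> = (a + b)\<^sup>2 * (t * (1 - t))"
    unfolding power_mult_distrib sq by simp
  finally have 1: "(cmod (cinner (T z) z))\<^sup>2 = (a + b)\<^sup>2 * (t * (1 - t))" .
  have "(norm (T z))\<^sup>2 = (?s * a)\<^sup>2 + (?c * b)\<^sup>2"
    unfolding T by (simp add: norm_Pair e(1))
  also have "\<dots> = a\<^sup>2 * t + b\<^sup>2 * (1 - t)"
    unfolding power_mult_distrib sq by simp
  finally have "((norm (T z))\<^sup>2)\<^sup>2 = (a\<^sup>2 * t + b\<^sup>2 * (1 - t))\<^sup>2"
    by simp
  with 1 show "(cmod (cinner (T z) z))\<^sup>2 + norm (T z) ^ 4
      = (a + b)\<^sup>2 * (t * (1 - t)) + (a\<^sup>2 * t + b\<^sup>2 * (1 - t))\<^sup>2"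
    by (simp flip: power_mult)
qed

theorem theorem3p17:
  fixes A B :: "'h::complex_hilbert \<Rightarrow> 'h"
  assumes "bounded_clinear A" and "bounded_clinear B"
    and "A \<noteq> (\<lambda>x. 0)" and "B \<noteq> (\<lambda>x. 0)"
  shows "let a = onorm A; b = onorm B;
             T = op_matrix (\<lambda>x. 0) A B (\<lambda>x. 0);
             M = (if - 1 / (2 * b\<^sup>2) < (a - b) / (a + b) \<and> (a - b) / (a + b) < 1 / (2 * a\<^sup>2)
                  then ((a + b)\<^sup>2 + 4 * a\<^sup>2 * b\<^sup>2) / (4 * (1 - (a - b)\<^sup>2))
                  else max (a ^ 4) (b ^ 4))
         in (dw T)\<^sup>2 \<le> M \<and>
            ((\<exists>u0 v0 :: 'h. u0 \<noteq> 0 \<and> v0 \<noteq> 0 \<and> A u0 = a *\<^sub>R u0 \<and> B v0 = b *\<^sub>R v0 \<and>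
                (\<exists>l::real. u0 = l *\<^sub>R v0))
             \<longrightarrow> (dw T)\<^sup>2 = M)"
proof -
  define a b T where "a = onorm A" and "b = onorm B" and "T = op_matrix (\<lambda>x. 0) A B (\<lambda>x. 0)"
  define M where "M = (if - 1 / (2 * b\<^sup>2) < (a - b) / (a + b) \<and> (a - b) / (a + b) < 1 / (2 * a\<^sup>2)
                  then ((a + b)\<^sup>2 + 4 * a\<^sup>2 * b\<^sup>2) / (4 * (1 - (a - b)\<^sup>2))
                  else max (a ^ 4) (b ^ 4))"
  have A: "bounded_linear A" and B: "bounded_linear B"
    using assms(1,2) by (auto simp: bounded_clinear_def)
  have a: "0 < a" and b: "0 < b"
    unfolding a_def b_def using onorm_pos_lt[OF A] onorm_pos_lt[OF B] assms(3,4) by auto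
  note g = dw_offdiag_quadratic_max[OF a b, folded M_def]
  have le: "(cmod (cinner (T z) z))\<^sup>2 + norm (T z) ^ 4 \<le> M" if "norm z = 1" for z
  proof (cases z)
    case (Pair x y)
    with that have unit: "norm (x, y) = 1" by simp
    have "(norm y)\<^sup>2 \<in> {0..1}"
      using norm_snd_le[of y x] unit by (simp add: power_le_one)
    then show ?thesis
      using offdiag_Davis_Wielandt_le[OF A B unit] g(1)
      unfolding Pair T_def a_def b_def by (blast intro: order_trans)
  qed
  \<comment> \<open>A non-zero operator needs a non-zero space, so the unit sphere is
    inhabited.\<close>
  obtain v where v: "A v \<noteq> 0"
    using assms(3) by auto
  then have "v \<noteq> 0"
    using linear_0[OF bounded_linear.linear[OF A]] by auto
  then have "norm (v /\<^sub>R norm v, 0 :: 'h) = 1"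
    by (simp add: norm_Pair)
  then have bound: "(dw T)\<^sup>2 \<le> M"
    using le by (rule dw_square_le)
  have attained: "(dw T)\<^sup>2 = M"
    if uv: "u0 \<noteq> 0" "A u0 = a *\<^sub>R u0" "B v0 = b *\<^sub>R v0" "u0 = l *\<^sub>R v0" for u0 v0 :: 'h and l :: real
  proof -
    \<comment> \<open>Eigenvectors are stable under scaling, so \<open>u0\<close>, a multiple of
      \<open>v0\<close>, is a common eigenvector of \<open>A\<close> and \<open>B\<close>.\<close>
    have Bu: "B u0 = b *\<^sub>R u0"
      using uv(3,4) by (simp add: linear_scale[OF bounded_linear.linear[OF B]])
    let ?e = "u0 /\<^sub>R norm u0"
    have e: "norm ?e = 1" "A ?e = a *\<^sub>R ?e" "B ?e = b *\<^sub>R ?e"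
      using uv(1,2) Bu by (simp_all add: linear_scale[OF bounded_linear.linear[OF A]] linear_scale[OF bounded_linear.linear[OF B]])
    \<comment> \<open>A maximiser of the quadratic; it fixes how the unit vector built from
      \<open>?e\<close> splits between the two summands.\<close>
    obtain t where t: "t \<in> {0..1}"
      and M: "(a + b)\<^sup>2 * (t * (1 - t)) + (a\<^sup>2 * t + b\<^sup>2 * (1 - t))\<^sup>2 = M"
      using g(2) by blast
    note z = offdiag_Davis_Wielandt_common_eigenvector[OF A B e t, folded T_def]
    show ?thesis
      using z(1) le z(2)[unfolded M] by (rule dw_square_eq)
  qed
  have "(dw T)\<^sup>2 \<le> M \<and>
    ((\<exists>u0 v0 :: 'h. u0 \<noteq> 0 \<and> v0 \<noteq> 0 \<and> A u0 = a *\<^sub>R u0 \<and> B v0 = b *\<^sub>R v0 \<and>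
      (\<exists>l::real. u0 = l *\<^sub>R v0)) \<longrightarrow> (dw T)\<^sup>2 = M)"
    using bound attained by blast
  then show ?thesis
    unfolding Let_def M_def T_def a_def b_def .
qed

end
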